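(* Let $\Omega(x,y)$ be a spacelike or timelike surface in $E_1^3$ with first fundamental form coefficients $g_{11}=\langle\Omega_x,\Omega_x\rangle$, $g_{12}=g_{21}=\langle\Omega_x,\Omega_y\rangle$, $g_{22}=\langle\Omega_y,\Omega_y\rangle$, and consider a loxodrome on $\Omega$ which cuts all meridians ($y=\text{constant}$) at a constant angle $\theta$, where the loxodrome and the meridians are each spacelike or timelike. Let $p,q,r\in\{1,-1\}$ be the signs of the causal types of the surface, the loxodrome and the meridians respectively ($1$ for spacelike, $-1$ for timelike). Then the loxodrome satisfies, for one of the two choices of the sign $\mp$ (at each point where the denominator is nonzero), $$\frac{dy}{dx}=\frac{-2pqr\,g_{11}g_{12}A^{2}\mp g_{11}\sqrt{p(g_{11}g_{22}-g_{12}^{2})}\,B}{2\left(g_{12}^{2}-qr\,g_{11}g_{22}(-pA^{2}+qr)\right)},$$ where $$(A,B)=\begin{cases}(\sin\theta,\ \sin(2\theta)) & \text{if } p=1,\\ (\sinh\theta,\ \sinh(2\theta)) & \text{if } p=-1 \text{ and } qr=1,\\ (\cosh\theta,\ \sinh(2\theta)) & \text{if } p=-1\text{ and } qr=-1.\end{cases}$$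
   Context: $E_1^3$ is $\mathbb{R}^3$ with the metric $\langle u,v\rangle=u_1v_1+u_2v_2-u_3v_3$, and $\|u\|=\sqrt{|\langle u,u\rangle|}$. A vector $u$ is spacelike if $\langle u,u\rangle>0$ or $u=0$, timelike if $\langle u,u\rangle<0$, lightlike if $\langle u,u\rangle=0$ (and $u\neq0$). A curve is spacelike (timelike) if all its tangent vectors are. A surface is spacelike (timelike) if all its tangent planes are spacelike (timelike), i.e. $g_{11}g_{22}-g_{12}^2>0$ (respectively $<0$). On a spacelike surface necessarily $q=r=1$. Meridians are the curves $y=\text{constant}$, with tangent $\Omega_x$. A loxodrome is a curve $t\mapsto\Omega(x(t),y(t))$ on the surface that cuts all meridians at a constant angle $\theta$. Here $dx/dt\neq0$, $dy/dx=\frac{dy/dt}{dx/dt}$, and with $T=\frac{dx}{dt}\Omega_x+\frac{dy}{dt}\Omega_y$ the constant angle $\theta$ condition means: - surface, loxodrome, meridian all spacelike ($p=q=r=1$): $\theta\in[0,\pi]$ and $\langle\Omega_x,T\rangle=\|\Omega_x\|\|T\|\cos\theta$; - timelike surface, loxodrome and meridian spacelike ($p=-1$, $q=r=1$): $\theta>0$ and $\langle\Omega_x,T\rangle=\varepsilon\|\Omega_x\|\|T\|\cosh\theta$ with $\varepsilon=\pm1$; - timelike surface, one of loxodrome and meridian spacelike and the other timelike ($p=-1$, $qr=-1$): $\theta\ge0$ and $\langle\Omega_x,T\rangle=\varepsilon\|\Omega_x\|\|T\|\sinh\theta$ with $\varepsilon=\pm1$; - timelike surface, loxodrome and meridian timelike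 ($p=q=r=-1$): $\theta>0$ and $\langle\Omega_x,T\rangle=-\|\Omega_x\|\|T\|\cosh\theta$. *)

theory Defs
  imports "HOL-Analysis.Analysis"
begin

section \<open>Minkowski 3-space\<close>

definition lor :: "real ^ 3 \<Rightarrow> real ^ 3 \<Rightarrow> real" where
  "lor u v = u $ 1 * v $ 1 + u $ 2 * v $ 2 - u $ 3 * v $ 3"

definition lnorm :: "real ^ 3 \<Rightarrow> real" where
  "lnorm u = sqrt \<bar>lor u u\<bar>"

definition spacelike :: "real ^ 3 \<Rightarrow> bool" where
  "spacelike u \<longleftrightarrow> lor u u > 0 \<or> u = 0"

definition timelike :: "real ^ 3 \<Rightarrow> bool" where
  "timelike u \<longleftrightarrow> lor u u < 0"

text \<open>The sign is 1 for spacelike and -1 for timelike; lightlike vectors have no sign.\<close>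

definition has_causal_sign :: "real ^ 3 \<Rightarrow> real \<Rightarrow> bool" where
  "has_causal_sign u s \<longleftrightarrow> s = 1 \<and> spacelike u \<or> s = -1 \<and> timelike u"

section \<open>Parametrized surfaces\<close>

definition dx :: "(real \<times> real \<Rightarrow> real ^ 3) \<Rightarrow> real \<times> real \<Rightarrow> real ^ 3" where
  "dx \<Omega> z = vector_derivative (\<lambda>s. \<Omega> (s, snd z)) (at (fst z))"

definition dy :: "(real \<times> real \<Rightarrow> real ^ 3) \<Rightarrow> real \<times> real \<Rightarrow> real ^ 3" where
  "dy \<Omega> z = vector_derivative (\<lambda>s. \<Omega> (fst z, s)) (at (snd z))"

definition g11 :: "(real \<times> real \<Rightarrow> real ^ 3) \<Rightarrow> real \<times> real \<Rightarrow> real" where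
  "g11 \<Omega> z = lor (dx \<Omega> z) (dx \<Omega> z)"

definition g12 :: "(real \<times> real \<Rightarrow> real ^ 3) \<Rightarrow> real \<times> real \<Rightarrow> real" where
  "g12 \<Omega> z = lor (dx \<Omega> z) (dy \<Omega> z)"

definition g22 :: "(real \<times> real \<Rightarrow> real ^ 3) \<Rightarrow> real \<times> real \<Rightarrow> real" where
  "g22 \<Omega> z = lor (dy \<Omega> z) (dy \<Omega> z)"

definition C1_surface :: "(real \<times> real \<Rightarrow> real ^ 3) \<Rightarrow> (real \<times> real) set \<Rightarrow> bool" where
  "C1_surface \<Omega> U \<longleftrightarrow> open U \<and> \<Omega> differentiable_on U \<and>
     continuous_on U (dx \<Omega>) \<and> continuous_on U (dy \<Omega>)"

definition spacelike_surface :: "(real \<times> real \<Rightarrow> real ^ 3) \<Rightarrow> (real \<times> real) set \<Rightarrow> bool" where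
  "spacelike_surface \<Omega> U \<longleftrightarrow> C1_surface \<Omega> U \<and>
     (\<forall>z\<in>U. g11 \<Omega> z * g22 \<Omega> z - (g12 \<Omega> z)\<^sup>2 > 0)"

definition timelike_surface :: "(real \<times> real \<Rightarrow> real ^ 3) \<Rightarrow> (real \<times> real) set \<Rightarrow> bool" where
  "timelike_surface \<Omega> U \<longleftrightarrow> C1_surface \<Omega> U \<and>
     (\<forall>z\<in>U. g11 \<Omega> z * g22 \<Omega> z - (g12 \<Omega> z)\<^sup>2 < 0)"

definition surface_has_causal_sign ::
    "(real \<times> real \<Rightarrow> real ^ 3) \<Rightarrow> (real \<times> real) set \<Rightarrow> real \<Rightarrow> bool" where
  "surface_has_causal_sign \<Omega> U p \<longleftrightarrow>
     p = 1 \<and> spacelike_surface \<Omega> U \<or> p = -1 \<and> timelike_surface \<Omega> U"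

text \<open>The meridians are the curves \<open>x \<mapsto> \<Omega> (x, y)\<close>, with tangent vectors \<open>dx \<Omega> (x, y)\<close>.\<close>

definition meridians_have_causal_sign ::
    "(real \<times> real \<Rightarrow> real ^ 3) \<Rightarrow> (real \<times> real) set \<Rightarrow> real \<Rightarrow> bool" where
  "meridians_have_causal_sign \<Omega> U r \<longleftrightarrow> (\<forall>z\<in>U. has_causal_sign (dx \<Omega> z) r)"

section \<open>Curves on a surface and loxodromes\<close>

text \<open>The tangent vector of \<open>t \<mapsto> \<Omega> (x t, y t)\<close>.\<close>

definition curve_tangent ::
    "(real \<times> real \<Rightarrow> real ^ 3) \<Rightarrow> (real \<Rightarrow> real) \<Rightarrow> (real \<Rightarrow> real) \<Rightarrow> real \<Rightarrow> real ^ 3" where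
  "curve_tangent \<Omega> x y t =
     deriv x t *\<^sub>R dx \<Omega> (x t, y t) + deriv y t *\<^sub>R dy \<Omega> (x t, y t)"

definition curve_has_causal_sign ::
    "(real \<times> real \<Rightarrow> real ^ 3) \<Rightarrow> real set \<Rightarrow> (real \<Rightarrow> real) \<Rightarrow> (real \<Rightarrow> real) \<Rightarrow> real \<Rightarrow> bool" where
  "curve_has_causal_sign \<Omega> I x y q \<longleftrightarrow>
     (\<forall>t\<in>I. has_causal_sign (curve_tangent \<Omega> x y t) q)"

text \<open>
  \<open>v\<close> is the tangent of the meridian and \<open>T\<close> that of the curve; \<open>p\<close>, \<open>q\<close>, \<open>r\<close> are the causal
  signs of the surface, the curve and the meridian. A spacelike surface forces \<open>q = r = 1\<close>,
  so the four cases are exhaustive.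
\<close>

definition makes_angle ::
    "real \<Rightarrow> real \<Rightarrow> real \<Rightarrow> real \<Rightarrow> real ^ 3 \<Rightarrow> real ^ 3 \<Rightarrow> bool" where
  "makes_angle p q r \<theta> v T \<longleftrightarrow>
     p = 1 \<and> q = 1 \<and> r = 1 \<and> \<theta> \<in> {0..pi} \<and>
       lor v T = lnorm v * lnorm T * cos \<theta> \<or>
     p = -1 \<and> q = 1 \<and> r = 1 \<and> \<theta> > 0 \<and>
       (\<exists>\<epsilon>\<in>{1, -1}. lor v T = \<epsilon> * lnorm v * lnorm T * cosh \<theta>) \<or>
     p = -1 \<and> q * r = -1 \<and> \<theta> \<ge> 0 \<and>
       (\<exists>\<epsilon>\<in>{1, -1}. lor v T = \<epsilon> * lnorm v * lnorm T * sinh \<theta>) \<or>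
     p = -1 \<and> q = -1 \<and> r = -1 \<and> \<theta> > 0 \<and>
       lor v T = - (lnorm v * lnorm T * cosh \<theta>)"

definition loxodrome ::
    "(real \<times> real \<Rightarrow> real ^ 3) \<Rightarrow> (real \<times> real) set \<Rightarrow> real set \<Rightarrow> (real \<Rightarrow> real) \<Rightarrow> (real \<Rightarrow> real) \<Rightarrow>
     real \<Rightarrow> real \<Rightarrow> real \<Rightarrow> real \<Rightarrow> bool" where
  "loxodrome \<Omega> U I x y p q r \<theta> \<longleftrightarrow>
     is_interval I \<and> x C1_differentiable_on I \<and> y C1_differentiable_on I \<and>
     (\<forall>t\<in>I. (x t, y t) \<in> U \<and> deriv x t \<noteq> 0 \<and>
        makes_angle p q r \<theta> (dx \<Omega> (x t, y t)) (curve_tangent \<Omega> x y t))"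

definition lox_A :: "real \<Rightarrow> real \<Rightarrow> real \<Rightarrow> real \<Rightarrow> real" where
  "lox_A p q r \<theta> = (if p = 1 then sin \<theta> else if q * r = 1 then sinh \<theta> else cosh \<theta>)"

definition lox_B :: "real \<Rightarrow> real \<Rightarrow> real" where
  "lox_B p \<theta> = (if p = 1 then sin (2 * \<theta>) else sinh (2 * \<theta>))"

end

theory Submission
  imports Defs
begin

text \<open>
  Write \<open>v = \<Omega>\<^sub>x\<close>, \<open>w = \<Omega>\<^sub>y\<close> and \<open>T = m v + n w\<close> for the tangent of the loxodrome, so that the slope
  is \<open>n / m\<close>, and let \<open>S = \<langle>T, T\<rangle>\<close> and \<open>W = E G - F\<^sup>2\<close>. The idea is that all the cases of the angle
  condition are one and the same. Let \<open>C\<close> be the function of \<open>\<theta>\<close> (\<open>cos\<close>, \<open>cosh\<close> or \<open>sinh\<close>) that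
  occurs in the angle condition. Then \<open>C\<^sup>2 = q r - p A\<^sup>2\<close> and \<open>B = 2 A C\<close>, and the squared angle
  condition is \<open>\<langle>v, T\<rangle>\<^sup>2 = C\<^sup>2 (q r E S)\<close> (\<open>makes_angle_power2\<close>). The Gram determinant of \<open>v\<close> and \<open>T\<close>
  is \<open>n\<^sup>2 W\<close>, whence the companion equation \<open>n\<^sup>2 (p W) = A\<^sup>2 (q r E S)\<close>. Together they say
  \<open>A \<langle>v, T\<rangle> = \<plusminus> C n \<surd>(p W)\<close>. This is a linear equation for \<open>n / m\<close>, because \<open>\<langle>v, T\<rangle> = m E + n F\<close>;
  solving it and rationalizing the denominator gives the formula (\<open>slope_from_linear_relation\<close>).

  The formula is claimed with one sign along the whole curve. If \<open>A C = 0\<close> both sides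
  of the linear equation vanish and any sign will do. Otherwise neither \<open>n\<close> nor \<open>\<langle>v, T\<rangle>\<close> can
  vanish, because \<open>q r E S\<close> is positive; so \<open>n \<langle>v, T\<rangle>\<close> is continuous without zeros on an
  interval and keeps its sign, and this sign determines the one in the equation.
\<close>

section \<open>The Lorentz product and causal signs\<close>

lemma lor_commute: "lor u v = lor v u"
  by (simp add: lor_def mult.commute)

lemma lor_add_right: "lor u (v + w) = lor u v + lor u w"
  by (simp add: lor_def algebra_simps)

lemma lor_scaleR_right: "lor u (a *\<^sub>R v) = a * lor u v"
  by (simp add: lor_def algebra_simps)

lemma lor_zero_left: "lor 0 v = 0"
  by (simp add: lor_def)

lemma continuous_on_lor:
  assumes "continuous_on S f" and "continuous_on S g"
  shows "continuous_on S (\<lambda>t. lor (f t) (g t))"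
  unfolding lor_def using assms by (intro continuous_intros)

text \<open>The Gram determinant is multiplied by the squared determinant of a change of basis, here
  from \<open>v, w\<close> to \<open>v, T\<close>.\<close>

lemma lor_gram_shear:
  fixes v w :: "real ^ 3" and m n :: real
  defines "T \<equiv> m *\<^sub>R v + n *\<^sub>R w"
  shows "lor v v * lor T T - (lor v T)\<^sup>2 = n\<^sup>2 * (lor v v * lor w w - (lor v w)\<^sup>2)"
proof -
  have T: "lor v T = m * lor v v + n * lor v w"
    unfolding T_def by (simp add: lor_add_right lor_scaleR_right)
  have "lor T T = m * lor v T + n * lor w T"
    using lor_add_right[of T "m *\<^sub>R v" "n *\<^sub>R w"]
    by (simp add: lor_scaleR_right lor_commute[of T v] lor_commute[of T w] flip: T_def)
  moreover have "lor w T = m * lor v w + n * lor w w"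
    unfolding T_def by (simp add: lor_add_right lor_scaleR_right lor_commute[of w v])
  ultimately show ?thesis
    unfolding T by (simp add: power2_eq_square algebra_simps)
qed

lemma lnorm_power2:
  assumes "has_causal_sign u s"
  shows "(lnorm u)\<^sup>2 = s * lor u u"
  using assms by (auto simp: lnorm_def has_causal_sign_def spacelike_def timelike_def lor_zero_left)

lemma causal_sign_pos:
  assumes "has_causal_sign u s" and "u \<noteq> 0"
  shows "0 < s * lor u u"
  using assms by (auto simp: has_causal_sign_def spacelike_def timelike_def)

section \<open>The angle condition\<close>

text \<open>The function of \<open>\<theta>\<close> to which the angle condition equates \<open>\<langle>v, T\<rangle> / (\<parallel>v\<parallel> \<parallel>T\<parallel>)\<close>, up to
  sign.\<close>

definition lox_C :: "real \<Rightarrow> real \<Rightarrow> real \<Rightarrow> real \<Rightarrow> real" where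
  "lox_C p q r \<theta> = (if p = 1 then cos \<theta> else if q * r = 1 then cosh \<theta> else sinh \<theta>)"

lemma lox_B_eq: "lox_B p \<theta> = 2 * lox_A p q r \<theta> * lox_C p q r \<theta>"
  by (simp add: lox_A_def lox_B_def lox_C_def sin_double sinh_double)

text \<open>The circular and hyperbolic Pythagorean identities in a single formula, which is what allows
  all causal types to be treated together.\<close>

lemma lox_C_power2:
  assumes "makes_angle p q r \<theta> v T"
  shows "(lox_C p q r \<theta>)\<^sup>2 = q * r - p * (lox_A p q r \<theta>)\<^sup>2"
  using assms by (auto simp: makes_angle_def lox_A_def lox_C_def cos_squared_eq cosh_square_eq)

lemma makes_angle_power2:
  assumes angle: "makes_angle p q r \<theta> v T"
    and v: "has_causal_sign v r" and T: "has_causal_sign T q"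
  shows "(lor v T)\<^sup>2 = (lox_C p q r \<theta>)\<^sup>2 * (q * r * lor v v * lor T T)"
proof -
  have "(lor v T)\<^sup>2 = (lnorm v)\<^sup>2 * (lnorm T)\<^sup>2 * (lox_C p q r \<theta>)\<^sup>2"
    using angle by (auto simp: makes_angle_def lox_C_def power_mult_distrib)
  then show ?thesis
    by (simp add: lnorm_power2[OF v] lnorm_power2[OF T])
qed

text \<open>The companion of the previous equation: by the Gram determinant the component of \<open>T\<close>
  transversal to \<open>v\<close> is measured by \<open>A\<close> as the component along \<open>v\<close> is by \<open>C\<close>.\<close>

lemma makes_angle_transversal_power2:
  fixes v w :: "real ^ 3" and m n :: real
  defines "T \<equiv> m *\<^sub>R v + n *\<^sub>R w"
  assumes signs: "p \<in> {1, -1}" "q \<in> {1, -1}" "r \<in> {1, -1}"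
    and angle: "makes_angle p q r \<theta> v T"
    and v: "has_causal_sign v r" and T: "has_causal_sign T q"
  shows "n\<^sup>2 * (p * (lor v v * lor w w - (lor v w)\<^sup>2)) =
    (lox_A p q r \<theta>)\<^sup>2 * (q * r * lor v v * lor T T)"
proof -
  let ?N = "lor v v * lor T T" and ?A = "lox_A p q r \<theta>"
  have "n\<^sup>2 * (lor v v * lor w w - (lor v w)\<^sup>2) = ?N - (q * r - p * ?A\<^sup>2) * (q * r * ?N)"
    using lor_gram_shear[of v m n w, folded T_def] makes_angle_power2[OF angle v T]
    by (simp add: lox_C_power2[OF angle] mult.assoc)
  moreover have "q * r * (q * r) = 1" and "p * p = 1"
    using signs by auto
  then have "p * (?N - (q * r - p * ?A\<^sup>2) * (q * r * ?N)) = ?A\<^sup>2 * (q * r * ?N)"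
    by algebra
  ultimately show ?thesis
    by (simp add: mult.left_commute mult.assoc)
qed

text \<open>The zero vector counts as spacelike, so the causal signs alone do not give strict positivity.
  Nondegeneracy of the surface supplies the rest: it makes \<open>v\<close> and \<open>w\<close> linearly independent,
  and then \<open>m \<noteq> 0\<close> excludes \<open>T = 0\<close>.\<close>

lemma lor_pos_of_nondegenerate:
  fixes v w :: "real ^ 3" and m n :: real
  defines "T \<equiv> m *\<^sub>R v + n *\<^sub>R w"
  assumes nondeg: "lor v v * lor w w - (lor v w)\<^sup>2 \<noteq> 0" and "m \<noteq> 0"
    and v: "has_causal_sign v r" and T: "has_causal_sign T q"
  shows "0 < q * r * lor v v * lor T T"
proof -
  have "v \<noteq> 0"
    using nondeg by (auto simp: lor_zero_left)
  have "T \<noteq> 0"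
  proof
    assume "T = 0"
    then have "n = 0"
      using lor_gram_shear[of v m n w, folded T_def] nondeg
      by (simp add: lor_zero_left lor_commute[of v 0])
    then show False
      using \<open>T = 0\<close> \<open>v \<noteq> 0\<close> \<open>m \<noteq> 0\<close> by (simp add: T_def)
  qed
  then show ?thesis
    using mult_pos_pos[OF causal_sign_pos[OF v \<open>v \<noteq> 0\<close>] causal_sign_pos[OF T]]
    by (simp add: mult_ac)
qed

section \<open>From the angle to the slope\<close>

text \<open>Multiplying \<open>n (\<eta> C d - F A) = m E A\<close> by the conjugate \<open>\<eta> C d + F A\<close> turns the factor of
  \<open>n\<close> into \<open>C\<^sup>2 d\<^sup>2 - F\<^sup>2 A\<^sup>2\<close>, which is \<open>- p q r D / 2\<close> for the denominator \<open>D\<close> below. The arguments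
  \<open>k\<close> and \<open>d\<close> stand for \<open>q r\<close> and \<open>\<surd>(p W)\<close>.\<close>

lemma slope_from_linear_relation:
  fixes E F G A C k p m n d \<eta> :: real
  defines "D \<equiv> 2 * (F\<^sup>2 - k * E * G * (- p * A\<^sup>2 + k))"
  assumes lin: "A * (m * E + n * F) = \<eta> * C * n * d"
    and "p * p = 1" and "k * k = 1" and "\<eta> * \<eta> = 1"
    and C: "C\<^sup>2 = k - p * A\<^sup>2" and d: "d\<^sup>2 = p * (E * G - F\<^sup>2)"
    and "m \<noteq> 0" and "D \<noteq> 0"
  shows "n / m = (- 2 * p * k * E * F * A\<^sup>2 - (p * k * \<eta>) * E * d * (2 * A * C)) / D"
proof -
  have "n * (C\<^sup>2 * d\<^sup>2 - F\<^sup>2 * A\<^sup>2) = m * E * A * (\<eta> * C * d + F * A)"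
    using lin \<open>\<eta> * \<eta> = 1\<close> by algebra
  moreover have "D = - 2 * p * k * (C\<^sup>2 * d\<^sup>2 - F\<^sup>2 * A\<^sup>2)"
    unfolding D_def C d using \<open>p * p = 1\<close> \<open>k * k = 1\<close> by algebra
  ultimately have "n * D = m * (- 2 * p * k * E * F * A\<^sup>2 - (p * k * \<eta>) * E * d * (2 * A * C))"
    by algebra
  then show ?thesis
    using \<open>m \<noteq> 0\<close> \<open>D \<noteq> 0\<close> by (simp add: frac_eq_eq mult.commute)
qed

lemma constant_sgn_on_interval:
  fixes h :: "real \<Rightarrow> real"
  assumes "is_interval I" and cont: "continuous_on I h" and nz: "\<And>t. t \<in> I \<Longrightarrow> h t \<noteq> 0"
  obtains s where "s \<in> {1, -1}" and "\<And>t. t \<in> I \<Longrightarrow> sgn (h t) = s"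
proof -
  have conn: "connected (h ` I)"
    using assms(1) by (intro connected_continuous_image[OF cont] is_interval_connected)
  have "(\<forall>t\<in>I. 0 < h t) \<or> (\<forall>t\<in>I. h t < 0)"
  proof (rule ccontr)
    assume "\<not> ?thesis"
    then obtain s t where "s \<in> I" "t \<in> I" "h s \<le> 0" "0 \<le> h t"
      by (auto simp: not_less)
    then have "0 \<in> h ` I"
      using connectedD_interval[OF conn, of "h s" "h t" 0] by auto
    then show False
      using nz by force
  qed
  then show thesis
    using that[of 1] that[of "-1"] by auto
qed

lemma C1_differentiable_continuous_deriv:
  fixes f :: "real \<Rightarrow> real"
  assumes "f C1_differentiable_on S"
  shows "continuous_on S (deriv f)"
proof -
  obtain D where D: "\<And>t. t \<in> S \<Longrightarrow> (f has_vector_derivative D t) (at t)" "continuous_on S D"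
    using assms by (auto simp: C1_differentiable_on_def)
  have "deriv f t = D t" if "t \<in> S" for t
    using D(1)[OF that] by (intro DERIV_imp_deriv)
      (simp add: has_real_derivative_iff_has_vector_derivative)
  then show ?thesis
    using D(2) by (simp cong: continuous_on_cong)
qed

theorem theorem1:
  fixes \<Omega> :: "real \<times> real \<Rightarrow> real ^ 3" and U :: "(real \<times> real) set"
    and I :: "real set" and x y :: "real \<Rightarrow> real" and p q r \<theta> :: real
  assumes "p \<in> {1, -1}" and "q \<in> {1, -1}" and "r \<in> {1, -1}"
    and "surface_has_causal_sign \<Omega> U p"
    and "meridians_have_causal_sign \<Omega> U r"
    and "curve_has_causal_sign \<Omega> I x y q"
    and "loxodrome \<Omega> U I x y p q r \<theta>"
  shows "\<exists>\<sigma>\<in>{1, -1}. \<forall>t\<in>I.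
    (let E = g11 \<Omega> (x t, y t); F = g12 \<Omega> (x t, y t); G = g22 \<Omega> (x t, y t);
         A = lox_A p q r \<theta>; B = lox_B p \<theta>;
         D = 2 * (F\<^sup>2 - q * r * E * G * (- p * A\<^sup>2 + q * r))
     in D \<noteq> 0 \<longrightarrow>
        deriv y t / deriv x t =
          (- 2 * p * q * r * E * F * A\<^sup>2 - \<sigma> * E * sqrt (p * (E * G - F\<^sup>2)) * B) / D)"
proof -
  define A C where "A = lox_A p q r \<theta>" and "C = lox_C p q r \<theta>"
  define v w T where "v = (\<lambda>t. dx \<Omega> (x t, y t))" and "w = (\<lambda>t. dy \<Omega> (x t, y t))"
    and "T = curve_tangent \<Omega> x y"
  define E F G where "E = (\<lambda>t. g11 \<Omega> (x t, y t))" and "F = (\<lambda>t. g12 \<Omega> (x t, y t))"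
    and "G = (\<lambda>t. g22 \<Omega> (x t, y t))"
  define root where "root = (\<lambda>t. sqrt (p * (E t * G t - (F t)\<^sup>2)))"
  define N where "N = (\<lambda>t. q * r * lor (v t) (v t) * lor (T t) (T t))"
  note gram = E_def F_def G_def g11_def g12_def g22_def
  have T_eq: "T t = deriv x t *\<^sub>R v t + deriv y t *\<^sub>R w t" for t
    by (simp add: T_def v_def w_def curve_tangent_def)

  have I: "is_interval I" and x: "x C1_differentiable_on I" and y: "y C1_differentiable_on I"
    using assms(7) by (auto simp: loxodrome_def)
  have inU: "(x t, y t) \<in> U" and dx0: "deriv x t \<noteq> 0"
    and angle: "makes_angle p q r \<theta> (v t) (T t)" if "t \<in> I" for t
    using assms(7) that by (auto simp: loxodrome_def v_def T_def)
  have v_sign: "has_causal_sign (v t) r" and T_sign: "has_causal_sign (T t) q" if "t \<in> I" for t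
    using assms(5,6) inU[OF that] that
    by (auto simp: meridians_have_causal_sign_def curve_has_causal_sign_def v_def T_def)
  have W_pos: "0 < p * (E t * G t - (F t)\<^sup>2)" if "t \<in> I" for t
    using assms(4) inU[OF that]
    by (auto simp: surface_has_causal_sign_def spacelike_surface_def timelike_surface_def
        E_def F_def G_def)
  have root2: "(root t)\<^sup>2 = p * (E t * G t - (F t)\<^sup>2)" if "t \<in> I" for t
    using W_pos[OF that] by (simp add: root_def)

  have vT: "(lor (v t) (T t))\<^sup>2 = C\<^sup>2 * N t" if "t \<in> I" for t
    using makes_angle_power2[OF angle v_sign T_sign] that by (simp add: C_def N_def)
  have yw: "(deriv y t * root t)\<^sup>2 = A\<^sup>2 * N t" if "t \<in> I" for t
    using makes_angle_transversal_power2[OF assms(1-3), of \<theta> "v t" "deriv x t" "deriv y t" "w t"]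
      angle[OF that] v_sign[OF that] T_sign[OF that] root2[OF that]
    by (simp add: A_def N_def T_eq power_mult_distrib gram v_def w_def)
  have N_pos: "0 < N t" if "t \<in> I" for t
    unfolding N_def T_eq
    using W_pos[OF that] dx0[OF that] v_sign[OF that] T_sign[OF that, unfolded T_eq]
    by (intro lor_pos_of_nondegenerate) (auto simp: gram v_def w_def)

  have "continuous_on U (dx \<Omega>)" "continuous_on U (dy \<Omega>)"
    using assms(4) by (auto simp: surface_has_causal_sign_def spacelike_surface_def
        timelike_surface_def C1_surface_def)
  moreover have "continuous_on I (\<lambda>t. (x t, y t))"
    using x y by (intro continuous_intros C1_differentiable_imp_continuous_on)
  ultimately have cont_vw: "continuous_on I v" "continuous_on I w"
    unfolding v_def w_def using inU by (auto intro: continuous_on_compose2)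
  have "continuous_on I T"
    unfolding T_eq using cont_vw C1_differentiable_continuous_deriv[OF x]
      C1_differentiable_continuous_deriv[OF y] by (intro continuous_intros)
  with cont_vw have cont: "continuous_on I (\<lambda>t. deriv y t * lor (v t) (T t))"
    by (intro continuous_intros continuous_on_lor C1_differentiable_continuous_deriv[OF y])

  obtain \<eta> :: real where \<eta>: "\<eta> \<in> {1, -1}"
    and lin: "\<And>t. t \<in> I \<Longrightarrow> A * lor (v t) (T t) = \<eta> * C * deriv y t * root t"
  proof (cases "A * C = 0")
    case True
    have "A * lor (v t) (T t) = 1 * C * deriv y t * root t" if "t \<in> I" for t
      using True vT[OF that] yw[OF that] by auto
    then show thesis
      using that[of 1] by blast
  next
    case False
    have nz: "deriv y t * lor (v t) (T t) \<noteq> 0" if "t \<in> I" for t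
      using False vT[OF that] yw[OF that] N_pos[OF that] by auto
    obtain s where s: "s \<in> {1, -1}" "\<And>t. t \<in> I \<Longrightarrow> sgn (deriv y t * lor (v t) (T t)) = s"
      using constant_sgn_on_interval[OF I cont nz] by blast
    have "A * lor (v t) (T t) = (s * sgn (A * C)) * C * deriv y t * root t" if t: "t \<in> I" for t
    proof -
      \<comment> \<open>Both sides have equal squares, hence equal absolute values; \<open>s * sgn (A * C)\<close> is the
        product of the signs of \<open>A * lor (v t) (T t)\<close> and \<open>C * deriv y t\<close>.\<close>
      have "(A * lor (v t) (T t))\<^sup>2 = (C * deriv y t * root t)\<^sup>2"
        using vT[OF t] yw[OF t] by (simp add: power_mult_distrib)
      then have "\<bar>A * lor (v t) (T t)\<bar> = \<bar>C * deriv y t * root t\<bar>"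
        by (simp add: abs_eq_iff power2_eq_iff)
      moreover have "0 < root t"
        using W_pos[OF t] by (simp add: root_def)
      ultimately have abs: "\<bar>A * lor (v t) (T t)\<bar> = \<bar>C * deriv y t\<bar> * root t"
        by (simp add: abs_mult)
      have "sgn (A * lor (v t) (T t)) * sgn (C * deriv y t) = s * sgn (A * C)"
        using s(2)[OF t] by (auto simp: sgn_mult mult_ac)
      moreover have "sgn (C * deriv y t) * sgn (C * deriv y t) = 1"
        using False nz[OF t] by (auto simp: sgn_if)
      ultimately have "sgn (A * lor (v t) (T t)) = s * sgn (A * C) * sgn (C * deriv y t)"
        by (metis mult.assoc mult.right_neutral)
      then have "A * lor (v t) (T t) =
          s * sgn (A * C) * (sgn (C * deriv y t) * \<bar>C * deriv y t\<bar>) * root t"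
        by (subst sgn_mult_abs[symmetric]) (simp only: abs mult_ac)
      then show ?thesis
        unfolding sgn_mult_abs by (simp only: mult_ac)
    qed
    moreover have "s * sgn (A * C) \<in> {1, -1}"
      using s(1) False by (auto simp: sgn_if)
    ultimately show thesis
      using that by blast
  qed

  show ?thesis
  proof (intro bexI[of _ "p * (q * r) * \<eta>"] ballI)
    show "p * (q * r) * \<eta> \<in> {1, -1}"
      using assms(1-3) \<eta> by auto
  next
    fix t assume t: "t \<in> I"
    have vT_eq: "lor (v t) (T t) = deriv x t * E t + deriv y t * F t"
      by (simp add: T_eq lor_add_right lor_scaleR_right gram v_def w_def)
    have "deriv y t / deriv x t =
        (- 2 * p * (q * r) * E t * F t * A\<^sup>2
          - (p * (q * r) * \<eta>) * E t * root t * (2 * A * C)) /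
        (2 * ((F t)\<^sup>2 - (q * r) * E t * G t * (- p * A\<^sup>2 + q * r)))"
      if "2 * ((F t)\<^sup>2 - (q * r) * E t * G t * (- p * A\<^sup>2 + q * r)) \<noteq> 0"
    proof (rule slope_from_linear_relation)
      show "A * (deriv x t * E t + deriv y t * F t) = \<eta> * C * deriv y t * root t"
        using lin[OF t] by (simp add: vT_eq)
      show "C\<^sup>2 = q * r - p * A\<^sup>2"
        using lox_C_power2[OF angle[OF t]] by (simp add: A_def C_def)
    qed (use that assms(1-3) \<eta> dx0[OF t] root2[OF t] in auto)
    then show "let E = g11 \<Omega> (x t, y t); F = g12 \<Omega> (x t, y t); G = g22 \<Omega> (x t, y t);
         A = lox_A p q r \<theta>; B = lox_B p \<theta>;
         D = 2 * (F\<^sup>2 - q * r * E * G * (- p * A\<^sup>2 + q * r))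
     in D \<noteq> 0 \<longrightarrow>
        deriv y t / deriv x t =
          (- 2 * p * q * r * E * F * A\<^sup>2
            - (p * (q * r) * \<eta>) * E * sqrt (p * (E * G - F\<^sup>2)) * B) / D"
      unfolding Let_def lox_B_eq[of p \<theta> q r]
        root_def A_def C_def E_def F_def G_def
      by (simp only: mult.assoc) blast
  qed
qed

end
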